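(* Let $(\mathcal{M},[\cdot,\cdot])$ be a Banach--Malcev algebra and let $\alpha:\mathcal{M}\to\mathcal{M}$ be a bounded linear map that is also a Malcev algebra morphism, i.e. $\alpha([x,y])=[\alpha(x),\alpha(y)]$ for all $x,y\in\mathcal{M}$. Put $[x,y]_\alpha:=\alpha([x,y])$. Then $(\mathcal{M},[\cdot,\cdot]_\alpha,\alpha)$ satisfies the Hom--Malcev identity: \[ J_\alpha(\alpha(x),\alpha(y),[x,z]_\alpha)=[J_\alpha(x,y,z),\alpha^2(x)]_\alpha\qquad\text{for all }x,y,z\in\mathcal{M}, \] where $J_\alpha(x,y,z):=[\alpha(x),[y,z]_\alpha]_\alpha+[\alpha(y),[z,x]_\alpha]_\alpha+[\alpha(z),[x,y]_\alpha]_\alpha$.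
   Context: A Malcev bracket on a complex vector space is a bilinear skew-symmetric bracket satisfying the Malcev identity $J(x,y,[x,z])=[J(x,y,z),x]$, where $J(x,y,z)=[x,[y,z]]+[y,[z,x]]+[z,[x,y]]$. A Banach--Malcev algebra is a complex Banach space with a continuous Malcev bracket. *)

theory Defs
  imports Complex_Main
begin

text \<open>
  The class \<^class>\<open>banach\<close> only provides real scalars. A complex Banach space is such a type with a
  complex scalar multiplication that extends the real one and for which the norm is homogeneous.
\<close>

locale complex_banach_space = vector_space scale
  for scale :: "complex \<Rightarrow> 'a::banach \<Rightarrow> 'a" +
  assumes scale_of_real: "scale (of_real r) x = r *\<^sub>R x"
    and norm_scale: "norm (scale c x) = cmod c * norm x"

definition jacobian :: "('a \<Rightarrow> 'a \<Rightarrow> 'a::ab_group_add) \<Rightarrow> 'a \<Rightarrow> 'a \<Rightarrow> 'a \<Rightarrow> 'a" where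
  "jacobian br x y z = br x (br y z) + br y (br z x) + br z (br x y)"

locale malcev_bracket = vector_space scale
  for scale :: "complex \<Rightarrow> 'a::ab_group_add \<Rightarrow> 'a" +
  fixes br :: "'a \<Rightarrow> 'a \<Rightarrow> 'a"
  assumes linear_right: "Vector_Spaces.linear scale scale (\<lambda>y. br x y)"
    and linear_left: "Vector_Spaces.linear scale scale (\<lambda>x. br x y)"
    and skew: "br x y = - br y x"
    and malcev: "jacobian br x y (br x z) = br (jacobian br x y z) x"

locale banach_malcev_algebra = complex_banach_space scale + malcev_bracket scale br
  for scale :: "complex \<Rightarrow> 'a::banach \<Rightarrow> 'a" and br :: "'a \<Rightarrow> 'a \<Rightarrow> 'a" +
  assumes continuous_br: "continuous_on UNIV (\<lambda>(x, y). br x y)"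

definition twisted :: "('a \<Rightarrow> 'a) \<Rightarrow> ('a \<Rightarrow> 'a \<Rightarrow> 'a) \<Rightarrow> 'a \<Rightarrow> 'a \<Rightarrow> 'a" where
  "twisted \<alpha> br x y = \<alpha> (br x y)"

definition hom_jacobian ::
    "('a \<Rightarrow> 'a) \<Rightarrow> ('a \<Rightarrow> 'a \<Rightarrow> 'a::ab_group_add) \<Rightarrow> 'a \<Rightarrow> 'a \<Rightarrow> 'a \<Rightarrow> 'a" where
  "hom_jacobian \<alpha> br x y z = br (\<alpha> x) (br y z) + br (\<alpha> y) (br z x) + br (\<alpha> z) (br x y)"

end

(* Twisting multiplies the Jacobian by alpha^2, so both sides of the Hom-Malcev identity are the
   image under alpha^3 of the corresponding side of the Malcev identity. *)
theory Submission
  imports Defs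
begin

text \<open>A morphism commutes with the Jacobian, and the twisted Jacobian is \<alpha>^2 applied to
  the ordinary one. On the left, the entries \<alpha> x, \<alpha> y, \<alpha> [x,z] contribute one
  further \<alpha>; on the right, the outer twisted bracket does. Applying \<alpha>^3 to the Malcev
  identity then gives the claim.\<close>

lemma jacobian_hom:
  fixes \<alpha> :: "'a::ab_group_add \<Rightarrow> 'a"
  assumes "additive \<alpha>" and "\<And>x y. \<alpha> (br x y) = br (\<alpha> x) (\<alpha> y)"
  shows "jacobian br (\<alpha> x) (\<alpha> y) (\<alpha> z) = \<alpha> (jacobian br x y z)"
  by (simp add: jacobian_def assms(2) additive.add[OF assms(1)])

text \<open>In each summand the inner twist matches the \<alpha> on the first entry, so one \<alpha>
  factors out of the outer bracket; the outer twist supplies the second.\<close>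

lemma hom_jacobian_twisted:
  fixes \<alpha> :: "'a::ab_group_add \<Rightarrow> 'a"
  assumes "additive \<alpha>" and "\<And>x y. \<alpha> (br x y) = br (\<alpha> x) (\<alpha> y)"
  shows "hom_jacobian \<alpha> (twisted \<alpha> br) x y z = \<alpha> (\<alpha> (jacobian br x y z))"
  by (simp add: hom_jacobian_def twisted_def jacobian_def assms(2) additive.add[OF assms(1)])

theorem theorem3p3:
  fixes scale :: "complex \<Rightarrow> 'a::banach \<Rightarrow> 'a"
    and br :: "'a \<Rightarrow> 'a \<Rightarrow> 'a"
    and \<alpha> :: "'a \<Rightarrow> 'a"
  assumes "banach_malcev_algebra scale br"
    and "Vector_Spaces.linear scale scale \<alpha>"
    and "bounded_linear \<alpha>"
    and "\<forall>x y. \<alpha> (br x y) = br (\<alpha> x) (\<alpha> y)"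
  shows "\<forall>x y z. hom_jacobian \<alpha> (twisted \<alpha> br) (\<alpha> x) (\<alpha> y) (twisted \<alpha> br x z)
           = twisted \<alpha> br (hom_jacobian \<alpha> (twisted \<alpha> br) x y z) ((\<alpha> ^^ 2) x)"
proof (intro allI)
  fix x y z
  interpret banach_malcev_algebra scale br by (fact assms(1))
  have add: "additive \<alpha>"
    using bounded_linear.axioms(1)[OF assms(3)] by (intro additive.intro) (rule Real_Vector_Spaces.linear_add)
  have hom: "\<alpha> (br u v) = br (\<alpha> u) (\<alpha> v)" for u v
    using assms(4) by blast
  have twist: "hom_jacobian \<alpha> (twisted \<alpha> br) u v w = \<alpha> (\<alpha> (jacobian br u v w))" for u v w
    by (rule hom_jacobian_twisted) (fact add, fact hom)
  have jac: "jacobian br (\<alpha> u) (\<alpha> v) (\<alpha> w) = \<alpha> (jacobian br u v w)" for u v w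
    by (rule jacobian_hom) (fact add, fact hom)
  have "hom_jacobian \<alpha> (twisted \<alpha> br) (\<alpha> x) (\<alpha> y) (twisted \<alpha> br x z)
      = \<alpha> (\<alpha> (\<alpha> (jacobian br x y (br x z))))"
    \<comment> \<open>\<open>hom\<close> is left out on purpose: it would push \<alpha> into
      \<open>br x z\<close>, and \<open>jac\<close> needs the third entry in the form
      \<open>\<alpha> (br x z)\<close>.\<close>
    by (simp only: twisted_def twist jac)
  also have "\<dots> = \<alpha> (\<alpha> (\<alpha> (br (jacobian br x y z) x)))"
    by (simp only: malcev)
  also have "\<dots> = twisted \<alpha> br (hom_jacobian \<alpha> (twisted \<alpha> br) x y z) ((\<alpha> ^^ 2) x)"
    \<comment> \<open>Here \<open>hom\<close> moves \<alpha> inward until both sides are the bracket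
      of \<alpha>^3 of the Jacobian with \<alpha>^3 of \<open>x\<close>.\<close>
    by (simp add: twist twisted_def hom numeral_2_eq_2)
  finally show "hom_jacobian \<alpha> (twisted \<alpha> br) (\<alpha> x) (\<alpha> y) (twisted \<alpha> br x z)
      = twisted \<alpha> br (hom_jacobian \<alpha> (twisted \<alpha> br) x y z) ((\<alpha> ^^ 2) x)" .
qed

end
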